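(* Let $d=1$ (one risky asset), $\mu>0$, $\sigma\neq0$, $\gamma\in\{-1,1\}$, $\sigma_Z\ge0$, $\mu_Z\in\mathbb{R}$, $\beta>0$, $\rho>0$, $p<1$. Put $\alpha:=\frac{\mu^2}{2\sigma^2}$ and $\eta:=\sigma_Z\gamma\mu/\sigma$. Assume $\mu_Z\ge\eta$ and $\rho>\rho_0$, where $\rho_0:=\max\{\mu_Z,\alpha p/(1-p)\}$ if $p\in(0,1)$ and $\rho_0:=\max\{\mu_Z,0\}$ if $p\le0$. Let $$\kappa:=\frac{-(\rho-\eta-\alpha)+\sqrt{(\rho-\eta-\alpha)^2+4\alpha(\rho-\mu_Z)}}{2\alpha}>0,\qquad p_1:=-\frac{\kappa}{1-\kappa}\in(-\infty,0),$$ and let the critical point $p_2>p_1$ be given by $$p_2:=\frac{\sigma\sigma_Z-\mu\kappa}{\mu(1-\kappa)+\sigma\sigma_Z}\in(-\infty,1).$$ Consider the optimal feedback control functions $\theta^*(x,z)$ and $c^*(x,z)$, $(x,z)\in\mathbb{R}_+^2$, given in the context. Then, for any fixed $z>0$: (i) $x\mapsto c^*(x,z)$ is increasing. (ii) If $p\in(p_1,1)$, $x\mapsto c^*(x,z)$ is strictly convex; if $p\in(-\infty,p_1)$, $x\mapsto c^*(x,z)$ is strictly concave; and if $p=p_1$, then $c^*(x,z)$ is linear in $x$. (iii) For the correlative coefficient $\gamma=1$, $x\mapsto\theta^*(x,z)$ is increasing. (iv) For the correlative coefficient $\gamma=1$: if $p\in(-\infty,p_1)\cup(p_2,1)$, $x\mapsto\theta^*(x,z)$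 is strictly convex; if $p\in(p_1,p_2)$, $x\mapsto\theta^*(x,z)$ is strictly concave; and if $p=p_1$ or $p=p_2$, $\theta^*(x,z)$ is linear in $x$.
   Context: $\mathbb{R}_+:=[0,\infty)$. The functions $\theta^*,c^*$ are the optimal feedback portfolio and consumption functions (in the reflected state $x$ and benchmark level $z$) for CRRA utility ($U(x)=x^p/p$ for $p<1$, $p\neq0$; $U(x)=\ln x$ for $p=0$) and a geometric Brownian benchmark $dZ_t=\mu_ZZ_tdt+\sigma_ZZ_t\gamma\,dW_t$, in a market with one risky asset of return rate $\mu$ and volatility $\sigma$ driven by the Brownian motion $W$, zero interest rate, discount rate $\rho$ and capital-injection cost parameter $\beta$. Explicitly, for $(x,z)\in\mathbb{R}_+^2$ let $f(x,z)\in(0,\beta]$ be the unique solution of $$x=\frac{(1-p)^2}{\rho(1-p)-\alpha p}\Big(f(x,z)^{-\frac{1}{1-p}}-\beta^{-\frac{1}{1-p}}\Big)+z\Big(\beta^{-(\kappa-1)}f(x,z)^{\kappa-1}-1\Big).$$ Then $$\theta^*(x,z)=\frac{\mu}{\sigma^2}\Big(\frac{1-p}{\rho(1-p)-\alpha p}f(x,z)^{-\frac1{1-p}}+(1-\kappa)\beta^{-(\kappa-1)}zf(x,z)^{\kappa-1}\Big)+\frac{\sigma_Z\gamma}{\sigma}z\beta^{-(\kappa-1)}f(x,z)^{\kappa-1},\qquad c^*(x,z)=f(x,z)^{\frac1{p-1}}.$$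
   Formalization: (ii), (iv) assume κ≠1 (if μ_Z=η then κ=1 and p₁ is undefined); (iii), (iv) assume σσ_Z≥0, and p₁<p₂<1 is claimed for κ≠1 and σσ_Z>0, since for σ<0<σ_Z it is false and (iv) or (iii) can fail; "linear" means affine. *)

theory Defs
  imports "HOL-Analysis.Analysis"
begin

definition strictly_convex_on :: "real set \<Rightarrow> (real \<Rightarrow> real) \<Rightarrow> bool" where
  "strictly_convex_on S g \<longleftrightarrow> convex S \<and>
     (\<forall>x\<in>S. \<forall>y\<in>S. \<forall>t. x \<noteq> y \<and> 0 < t \<and> t < 1 \<longrightarrow>
        g ((1 - t) * x + t * y) < (1 - t) * g x + t * g y)"

definition strictly_concave_on :: "real set \<Rightarrow> (real \<Rightarrow> real) \<Rightarrow> bool" where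
  "strictly_concave_on S g \<longleftrightarrow> strictly_convex_on S (\<lambda>x. - g x)"

text \<open>``Linear in \<open>x\<close>'' allows a constant term: the functions it is applied to do
  not vanish at \<open>x = 0\<close>.\<close>

definition linear_in_on :: "real set \<Rightarrow> (real \<Rightarrow> real) \<Rightarrow> bool" where
  "linear_in_on S g \<longleftrightarrow> (\<exists>a b. \<forall>x\<in>S. g x = a * x + b)"

definition rho0 :: "real \<Rightarrow> real \<Rightarrow> real \<Rightarrow> real" where
  "rho0 p \<alpha> \<mu>\<^sub>Z = (if 0 < p then max \<mu>\<^sub>Z (\<alpha> * p / (1 - p)) else max \<mu>\<^sub>Z 0)"

text \<open>The function \<open>f(x,z)\<close> with values in \<open>(0,\<beta>]\<close>. The definite description is
  meaningful for \<open>x, z \<ge> 0\<close> under the standing assumptions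
  (\<open>\<rho> (1 - p) > \<alpha> p\<close> and \<open>\<kappa> \<le> 1\<close>), where the right-hand side decreases strictly in \<open>y\<close>
  from \<open>\<infinity>\<close> to \<open>0\<close>.\<close>

definition f_dual :: "real \<Rightarrow> real \<Rightarrow> real \<Rightarrow> real \<Rightarrow> real \<Rightarrow> real \<Rightarrow> real \<Rightarrow> real" where
  "f_dual p \<rho> \<beta> \<alpha> \<kappa> x z = (THE y. 0 < y \<and> y \<le> \<beta> \<and>
     x = (1 - p)^2 / (\<rho> * (1 - p) - \<alpha> * p)
           * (y powr (- (1 / (1 - p))) - \<beta> powr (- (1 / (1 - p))))
         + z * (\<beta> powr (- (\<kappa> - 1)) * y powr (\<kappa> - 1) - 1))"

definition theta_star ::
  "real \<Rightarrow> real \<Rightarrow> real \<Rightarrow> real \<Rightarrow> real \<Rightarrow> real \<Rightarrow> real \<Rightarrow> real \<Rightarrow> real \<Rightarrow> real \<Rightarrow> real \<Rightarrow> real" where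
  "theta_star \<mu> \<sigma> \<sigma>\<^sub>Z \<gamma> p \<rho> \<beta> \<alpha> \<kappa> x z =
     \<mu> / \<sigma>^2 *
       ((1 - p) / (\<rho> * (1 - p) - \<alpha> * p) * f_dual p \<rho> \<beta> \<alpha> \<kappa> x z powr (- (1 / (1 - p)))
        + (1 - \<kappa>) * \<beta> powr (- (\<kappa> - 1)) * z * f_dual p \<rho> \<beta> \<alpha> \<kappa> x z powr (\<kappa> - 1))
     + \<sigma>\<^sub>Z * \<gamma> / \<sigma> * z * \<beta> powr (- (\<kappa> - 1)) * f_dual p \<rho> \<beta> \<alpha> \<kappa> x z powr (\<kappa> - 1)"

definition c_star :: "real \<Rightarrow> real \<Rightarrow> real \<Rightarrow> real \<Rightarrow> real \<Rightarrow> real \<Rightarrow> real \<Rightarrow> real" where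
  "c_star p \<rho> \<beta> \<alpha> \<kappa> x z = f_dual p \<rho> \<beta> \<alpha> \<kappa> x z powr (1 / (p - 1))"

end

theory Submission
  imports Defs
begin

text \<open>Parametrise by consumption \<open>c = f powr (-1/(1-p))\<close>: the equation defining \<open>f\<close> becomes
  \<open>x = A (c - c\<^sub>0) + z (B c\<^sup>r - 1)\<close> with \<open>r = (1 - \<kappa>)(1 - p)\<close>. Hence \<open>x \<mapsto> c\<close> is the inverse of an
  increasing function which is strictly concave, affine or strictly convex according to whether
  \<open>r < 1\<close>, \<open>r = 1\<close> or \<open>r > 1\<close>, that is \<open>p > p\<^sub>1\<close>, \<open>p = p\<^sub>1\<close> or \<open>p < p\<^sub>1\<close>. Eliminating \<open>z B c\<^sup>r\<close> by means
  of the same equation, \<open>\<theta>\<^sup>*\<close> is an affine function of \<open>x\<close> plus \<open>K c\<close>, and \<open>K\<close> has the sign of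
  \<open>p - p\<^sub>2\<close>.\<close>

section \<open>Strict convexity: affine perturbations, derivatives and powers\<close>

text \<open>An affine summand satisfies Jensen's inequality with equality, and a factor
  \<open>k > 0\<close> keeps it strict. This carries curvature from the power to the wealth
  function, and from consumption to the portfolio.\<close>

lemma strictly_convex_on_affine_combination:
  assumes "strictly_convex_on S g" "k > 0" "\<And>x. x \<in> S \<Longrightarrow> h x = k * g x + (m * x + b)"
  shows "strictly_convex_on S h"
  unfolding strictly_convex_on_def
proof (intro conjI ballI allI impI)
  show S: "convex S"
    using assms(1) by (simp add: strictly_convex_on_def)
  fix x y t :: real
  assume x: "x \<in> S" and y: "y \<in> S" and t: "x \<noteq> y \<and> 0 < t \<and> t < 1"
  have "(1 - t) * x + t * y \<in> S"
    using convexD[OF S x y, of "1 - t" t] t by simp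
  moreover have "k * g ((1 - t) * x + t * y) < k * ((1 - t) * g x + t * g y)"
    using assms(1,2) x y t by (simp add: strictly_convex_on_def)
  ultimately show "h ((1 - t) * x + t * y) < (1 - t) * h x + t * h y"
    using assms(3) x y by (simp add: algebra_simps)
qed

text \<open>The mean value theorem on either side of the intermediate point \<open>m\<close> gives
  two derivative values, and the left one is smaller.\<close>

lemma strictly_convex_on_deriv_strict_mono:
  fixes g :: "real \<Rightarrow> real"
  assumes S: "convex S"
    and deriv: "\<And>x. x \<in> S \<Longrightarrow> (g has_real_derivative g' x) (at x)"
    and mono: "\<And>x y. x \<in> S \<Longrightarrow> y \<in> S \<Longrightarrow> x < y \<Longrightarrow> g' x < g' y"
  shows "strictly_convex_on S g"
proof -
  have less: "g ((1 - t) * x + t * y) < (1 - t) * g x + t * g y"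
    if x: "x \<in> S" and y: "y \<in> S" and "x < y" and t: "0 < t" "t < 1" for x y t :: real
  proof -
    define m where "m = (1 - t) * x + t * y"
    have m: "m - x = t * (y - x)" "y - m = (1 - t) * (y - x)"
      by (simp_all add: m_def algebra_simps)
    have "x < m" "m < y"
      using m t \<open>x < y\<close> mult_pos_pos[of t "y - x"] mult_pos_pos[of "1 - t" "y - x"] by linarith+
    have "{x..y} \<subseteq> S"
      using closed_segment_subset[OF x y S] \<open>x < y\<close> by (simp add: closed_segment_eq_real_ivl1)
    hence in_S: "u \<in> S" if "x \<le> u" "u \<le> y" for u
      using that by auto
    obtain u where u: "x < u" "u < m" "g m - g x = (m - x) * g' u"
      using MVT2[OF \<open>x < m\<close>, of g g'] deriv in_S \<open>m < y\<close> by auto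
    obtain v where v: "m < v" "v < y" "g y - g m = (y - m) * g' v"
      using MVT2[OF \<open>m < y\<close>, of g g'] deriv in_S \<open>x < m\<close> by auto
    have "g' u < g' v"
      using mono in_S u v by simp
    \<comment> \<open>After weighting the left increment by \<open>1 - t\<close> and the right one
      by \<open>t\<close>, both carry this common factor.\<close>
    hence "(t * (1 - t) * (y - x)) * g' u < (t * (1 - t) * (y - x)) * g' v"
      using t \<open>x < y\<close> by simp
    hence "(1 - t) * (g m - g x) < t * (g y - g m)"
      unfolding u(3) v(3) m by (simp add: mult_ac)
    thus ?thesis
      unfolding m_def[symmetric] by (simp add: algebra_simps)
  qed
  show ?thesis
    unfolding strictly_convex_on_def
  proof (intro conjI ballI allI impI S)
    fix x y t :: real
    assume xy: "x \<in> S" "y \<in> S" and t: "x \<noteq> y \<and> 0 < t \<and> t < 1"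
    show "g ((1 - t) * x + t * y) < (1 - t) * g x + t * g y"
    proof (cases "x < y")
      case True
      then show ?thesis
        using less xy t by blast
    next
      case False
      then show ?thesis
        using less[of y x "1 - t"] xy t by (simp add: add.commute)
    qed
  qed
qed

lemma strictly_convex_on_powr:
  fixes r :: real
  assumes "r > 1"
  shows "strictly_convex_on {0<..} (\<lambda>x. x powr r)"
  by (rule strictly_convex_on_deriv_strict_mono[where g' = "\<lambda>x. r * x powr (r - 1)"])
    (use assms in \<open>auto intro!: derivative_eq_intros powr_less_mono2\<close>)

lemma strictly_concave_on_powr:
  fixes r :: real
  assumes "0 < r" "r < 1"
  shows "strictly_concave_on {0<..} (\<lambda>x. x powr r)"
  unfolding strictly_concave_on_def
  by (rule strictly_convex_on_deriv_strict_mono[where g' = "\<lambda>x. - (r * x powr (r - 1))"])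
    (use assms in \<open>auto intro!: derivative_eq_intros powr_less_mono2_neg\<close>)

section \<open>Curvature and monotonicity of inverse functions\<close>

text \<open>At the chord point of \<open>g\<close>, concavity makes \<open>h\<close> larger than the
  chord of \<open>h o g\<close>, which is the identity. Monotonicity of \<open>h\<close> then allows
  \<open>h\<close> to be cancelled. Only \<open>h (g x) = x\<close> is asked of \<open>g\<close>,
  not continuity.\<close>

lemma strictly_convex_on_inverse:
  fixes g h :: "real \<Rightarrow> real"
  assumes h: "strictly_concave_on T h" "strict_mono_on T h"
    and g: "convex S" "\<And>x. x \<in> S \<Longrightarrow> g x \<in> T" "\<And>x. x \<in> S \<Longrightarrow> h (g x) = x"
  shows "strictly_convex_on S g"
  unfolding strictly_convex_on_def
proof (intro conjI ballI allI impI g(1))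
  fix x y t :: real
  assume x: "x \<in> S" and y: "y \<in> S" and t: "x \<noteq> y \<and> 0 < t \<and> t < 1"
  have T: "convex T"
    using h(1) by (simp add: strictly_concave_on_def strictly_convex_on_def)
  have m: "(1 - t) * x + t * y \<in> S"
    using convexD[OF g(1) x y, of "1 - t" t] t by simp
  have gm: "(1 - t) * g x + t * g y \<in> T"
    using convexD[OF T g(2)[OF x] g(2)[OF y], of "1 - t" t] t by simp
  \<comment> \<open>Strictness requires distinct points; \<open>g\<close> is injective because
    \<open>h\<close> undoes it.\<close>
  have "g x \<noteq> g y"
    using g(3) x y t by metis
  hence "- h ((1 - t) * g x + t * g y) < (1 - t) * - h (g x) + t * - h (g y)"
    using h(1) g(2) x y t unfolding strictly_concave_on_def strictly_convex_on_def by blast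
  hence "h (g ((1 - t) * x + t * y)) < h ((1 - t) * g x + t * g y)"
    using g(3) x y m by simp
  thus "g ((1 - t) * x + t * y) < (1 - t) * g x + t * g y"
    using strict_mono_on_less[OF h(2) g(2)[OF m] gm] by simp
qed

text \<open>The same cancellation of \<open>h\<close>, with the inequality reversed.\<close>

lemma strictly_concave_on_inverse:
  fixes g h :: "real \<Rightarrow> real"
  assumes h: "strictly_convex_on T h" "strict_mono_on T h"
    and g: "convex S" "\<And>x. x \<in> S \<Longrightarrow> g x \<in> T" "\<And>x. x \<in> S \<Longrightarrow> h (g x) = x"
  shows "strictly_concave_on S g"
  unfolding strictly_concave_on_def strictly_convex_on_def
proof (intro conjI ballI allI impI g(1))
  fix x y t :: real
  assume x: "x \<in> S" and y: "y \<in> S" and t: "x \<noteq> y \<and> 0 < t \<and> t < 1"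
  have T: "convex T"
    using h(1) by (simp add: strictly_convex_on_def)
  have m: "(1 - t) * x + t * y \<in> S"
    using convexD[OF g(1) x y, of "1 - t" t] t by simp
  have gm: "(1 - t) * g x + t * g y \<in> T"
    using convexD[OF T g(2)[OF x] g(2)[OF y], of "1 - t" t] t by simp
  have "g x \<noteq> g y"
    using g(3) x y t by metis
  hence "h ((1 - t) * g x + t * g y) < (1 - t) * h (g x) + t * h (g y)"
    using h(1) g(2) x y t unfolding strictly_convex_on_def by blast
  hence "h ((1 - t) * g x + t * g y) < h (g ((1 - t) * x + t * y))"
    using g(3) x y m by simp
  thus "- g ((1 - t) * x + t * y) < (1 - t) * - g x + t * - g y"
    using strict_mono_on_less[OF h(2) gm g(2)[OF m]] by simp
qed

lemma strict_mono_on_inverse: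
  fixes g h :: "real \<Rightarrow> real"
  assumes h: "strict_mono_on T h"
    and g: "\<And>x. x \<in> S \<Longrightarrow> g x \<in> T" "\<And>x. x \<in> S \<Longrightarrow> h (g x) = x"
  shows "strict_mono_on S g"
  using strict_mono_on_less[OF h g(1) g(1)] g(2) by (auto intro!: strict_mono_onI)

section \<open>The equation defining \<open>f_dual\<close>\<close>

definition dual_rhs :: "real \<Rightarrow> real \<Rightarrow> real \<Rightarrow> real \<Rightarrow> real \<Rightarrow> real \<Rightarrow> real \<Rightarrow> real" where
  "dual_rhs p \<rho> \<beta> \<alpha> \<kappa> z y = (1 - p)^2 / (\<rho> * (1 - p) - \<alpha> * p)
       * (y powr (- (1 / (1 - p))) - \<beta> powr (- (1 / (1 - p))))
     + z * (\<beta> powr (- (\<kappa> - 1)) * y powr (\<kappa> - 1) - 1)"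

text \<open>Resolves the definite description. Uniqueness: the first summand decreases strictly in
  \<open>y\<close> and the second does not increase, as \<kappa> \<le> 1. Existence: intermediate
  value theorem.\<close>

lemma f_dual:
  fixes p \<rho> \<beta> \<alpha> \<kappa> x z :: real
  assumes p: "p < 1" and D: "\<rho> * (1 - p) - \<alpha> * p > 0" and "\<beta> > 0" and "\<kappa> \<le> 1"
    and "x \<ge> 0" and "z \<ge> 0"
  shows "f_dual p \<rho> \<beta> \<alpha> \<kappa> x z > 0"
    and "dual_rhs p \<rho> \<beta> \<alpha> \<kappa> z (f_dual p \<rho> \<beta> \<alpha> \<kappa> x z) = x"
proof -
  let ?y = "f_dual p \<rho> \<beta> \<alpha> \<kappa> x z"
  define A where "A = (1 - p)^2 / (\<rho> * (1 - p) - \<alpha> * p)"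
  define q where "q = 1 / (1 - p)"
  define G where "G = dual_rhs p \<rho> \<beta> \<alpha> \<kappa> z"
  have pos: "A > 0" "q > 0"
    using p D by (simp_all add: A_def q_def)
  have G: "G y = A * (y powr (- q) - \<beta> powr (- q)) + z * (\<beta> powr (- (\<kappa> - 1)) * y powr (\<kappa> - 1) - 1)" for y
    by (simp add: G_def dual_rhs_def A_def q_def)
  have dec: "G v < G u" if "0 < u" "u < v" for u v
  proof -
    have "A * v powr (- q) < A * u powr (- q)"
      using pos that by (simp add: powr_less_mono2_neg)
    moreover have "z * (\<beta> powr (- (\<kappa> - 1)) * v powr (\<kappa> - 1)) \<le> z * (\<beta> powr (- (\<kappa> - 1)) * u powr (\<kappa> - 1))"
      using \<open>z \<ge> 0\<close> \<open>\<kappa> \<le> 1\<close> that by (intro mult_left_mono powr_mono2') auto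
    ultimately show ?thesis
      by (simp add: G algebra_simps)
  qed
  \<comment> \<open>The solution of the equation without its \<open>z\<close> summand. That summand
    is nonnegative on \<open>y \<le> \<beta>\<close>, so \<open>G y0 \<ge> x\<close>, and
    \<open>y0\<close> is a left end point for the intermediate value theorem.\<close>
  define y0 where "y0 = (\<beta> powr (- q) + x / A) powr (- (1 / q))"
  have base: "\<beta> powr (- q) > 0" "x / A \<ge> 0"
    using \<open>\<beta> > 0\<close> \<open>x \<ge> 0\<close> pos by simp_all
  have base_pos: "\<beta> powr (- q) + x / A > 0"
    using base by linarith
  hence "y0 > 0"
    unfolding y0_def by (metis less_numeral_extra(3) powr_gt_zero)
  have "y0 \<le> (\<beta> powr (- q)) powr (- (1 / q))"
    unfolding y0_def using base pos by (intro powr_mono2') auto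
  hence "y0 \<le> \<beta>"
    using \<open>\<beta> > 0\<close> pos by (simp add: powr_powr)
  have ratio: "\<beta> powr (- (\<kappa> - 1)) * \<beta> powr (\<kappa> - 1) = 1"
    using \<open>\<beta> > 0\<close> by (simp flip: powr_add)
  have "\<beta> powr (- (\<kappa> - 1)) * \<beta> powr (\<kappa> - 1) \<le> \<beta> powr (- (\<kappa> - 1)) * y0 powr (\<kappa> - 1)"
    using \<open>y0 > 0\<close> \<open>y0 \<le> \<beta>\<close> \<open>\<kappa> \<le> 1\<close> by (intro mult_left_mono powr_mono2') auto
  hence "0 \<le> z * (\<beta> powr (- (\<kappa> - 1)) * y0 powr (\<kappa> - 1) - 1)"
    using ratio \<open>z \<ge> 0\<close> by simp
  moreover have "y0 powr (- q) = \<beta> powr (- q) + x / A"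
    using base_pos pos by (simp add: y0_def powr_powr)
  ultimately have "x \<le> G y0"
    using pos by (simp add: G)
  \<comment> \<open>In fact \<open>G \<beta> = 0\<close>.\<close>
  moreover have "G \<beta> \<le> x"
    using ratio \<open>x \<ge> 0\<close> by (simp add: G)
  moreover have "continuous_on {y0..\<beta>} G"
    unfolding G using \<open>y0 > 0\<close> by (auto intro!: continuous_intros)
  ultimately obtain y where "y0 \<le> y" "y \<le> \<beta>" "G y = x"
    using IVT2'[of G \<beta> x y0] \<open>y0 \<le> \<beta>\<close> by auto
  hence "0 < y \<and> y \<le> \<beta> \<and> x = G y"
    using \<open>y0 > 0\<close> by simp
  moreover have "u = v" if "0 < u" "0 < v" "G u = G v" for u v
    using dec[of u v] dec[of v u] that by (cases u v rule: linorder_cases) auto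
  ultimately have "\<exists>!y. 0 < y \<and> y \<le> \<beta> \<and> x = G y"
    by metis
  moreover have "?y = (THE y. 0 < y \<and> y \<le> \<beta> \<and> x = G y)"
    by (simp add: f_dual_def G_def dual_rhs_def)
  ultimately have "0 < ?y \<and> ?y \<le> \<beta> \<and> x = G ?y"
    using theI'[of "\<lambda>y. 0 < y \<and> y \<le> \<beta> \<and> x = G y"] by simp
  thus "?y > 0" "dual_rhs p \<rho> \<beta> \<alpha> \<kappa> z ?y = x"
    by (simp_all add: G_def)
qed

section \<open>Consumption as the new variable\<close>

text \<open>This is \<open>dual_rhs\<close> after the substitution
  \<open>y = c powr (p - 1)\<close>.\<close>

definition wealth_of_consumption ::
  "real \<Rightarrow> real \<Rightarrow> real \<Rightarrow> real \<Rightarrow> real \<Rightarrow> real \<Rightarrow> real \<Rightarrow> real" where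
  "wealth_of_consumption p \<rho> \<beta> \<alpha> \<kappa> z c =
     (1 - p)^2 / (\<rho> * (1 - p) - \<alpha> * p) * (c - \<beta> powr (- (1 / (1 - p))))
     + z * (\<beta> powr (- (\<kappa> - 1)) * c powr ((1 - \<kappa>) * (1 - p)) - 1)"

lemma c_star:
  fixes p \<rho> \<beta> \<alpha> \<kappa> x z :: real
  assumes "p < 1" "\<rho> * (1 - p) - \<alpha> * p > 0" "\<beta> > 0" "\<kappa> \<le> 1" "x \<ge> 0" "z \<ge> 0"
  shows c_star_pos: "c_star p \<rho> \<beta> \<alpha> \<kappa> x z > 0"
    and f_dual_powr_kappa:
      "f_dual p \<rho> \<beta> \<alpha> \<kappa> x z powr (\<kappa> - 1) = c_star p \<rho> \<beta> \<alpha> \<kappa> x z powr ((1 - \<kappa>) * (1 - p))"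
    and f_dual_powr_p: "f_dual p \<rho> \<beta> \<alpha> \<kappa> x z powr (- (1 / (1 - p))) = c_star p \<rho> \<beta> \<alpha> \<kappa> x z"
    and wealth_of_c_star: "wealth_of_consumption p \<rho> \<beta> \<alpha> \<kappa> z (c_star p \<rho> \<beta> \<alpha> \<kappa> x z) = x"
proof -
  note f = f_dual[OF assms]
  show "c_star p \<rho> \<beta> \<alpha> \<kappa> x z > 0"
    using f(1) by (simp add: c_star_def)
  have "- (1 / (1 - p)) = 1 / (p - 1)"
    by (metis minus_diff_eq minus_divide_right)
  thus 1: "f_dual p \<rho> \<beta> \<alpha> \<kappa> x z powr (- (1 / (1 - p))) = c_star p \<rho> \<beta> \<alpha> \<kappa> x z"
    by (simp only: c_star_def)
  have "- (1 / (1 - p)) * ((1 - \<kappa>) * (1 - p)) = \<kappa> - 1"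
    using \<open>p < 1\<close> by (simp add: field_simps)
  thus 2: "f_dual p \<rho> \<beta> \<alpha> \<kappa> x z powr (\<kappa> - 1) = c_star p \<rho> \<beta> \<alpha> \<kappa> x z powr ((1 - \<kappa>) * (1 - p))"
    unfolding 1[symmetric] powr_powr by simp
  show "wealth_of_consumption p \<rho> \<beta> \<alpha> \<kappa> z (c_star p \<rho> \<beta> \<alpha> \<kappa> x z) = x"
    using f(2) by (simp only: dual_rhs_def wealth_of_consumption_def 1 2)
qed

text \<open>The linear term has a positive coefficient and supplies strictness; the power term has a
  nonnegative exponent and is only nondecreasing (constant when \<kappa> = 1).\<close>

lemma wealth_of_consumption_strict_mono:
  fixes p \<rho> \<beta> \<alpha> \<kappa> z :: real
  assumes "p < 1" "\<rho> * (1 - p) - \<alpha> * p > 0" "\<kappa> \<le> 1" "z \<ge> 0"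
  shows "strict_mono_on {0<..} (wealth_of_consumption p \<rho> \<beta> \<alpha> \<kappa> z)"
  unfolding wealth_of_consumption_def using assms
  by (intro strict_mono_onI add_less_le_mono mult_strict_left_mono mult_left_mono diff_right_mono
      diff_strict_right_mono powr_mono2) auto

text \<open>Isolates the power, the only nonlinear term, in the shape that
  \<open>strictly_convex_on_affine_combination\<close> expects.\<close>

lemma wealth_of_consumption_split:
  "wealth_of_consumption p \<rho> \<beta> \<alpha> \<kappa> z c =
     z * \<beta> powr (- (\<kappa> - 1)) * c powr ((1 - \<kappa>) * (1 - p))
     + ((1 - p)^2 / (\<rho> * (1 - p) - \<alpha> * p) * c
        + (- ((1 - p)^2 / (\<rho> * (1 - p) - \<alpha> * p) * \<beta> powr (- (1 / (1 - p)))) - z))"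
proof -
  have "A * (c - b) + z * (B * e - 1) = z * B * e + (A * c + (- (A * b) - z))" for A B b e :: real
    by (simp add: algebra_simps)
  thus ?thesis
    unfolding wealth_of_consumption_def .
qed

section \<open>Monotonicity and curvature of the feedback functions\<close>

context
  fixes p \<rho> \<beta> \<alpha> \<kappa> z :: real
  assumes p: "p < 1" and D: "\<rho> * (1 - p) - \<alpha> * p > 0" and \<beta>: "\<beta> > 0" and z: "z > 0"
begin

lemma c_star_strict_mono:
  assumes "\<kappa> \<le> 1"
  shows "strict_mono_on {0..} (\<lambda>x. c_star p \<rho> \<beta> \<alpha> \<kappa> x z)"
  by (rule strict_mono_on_inverse[OF wealth_of_consumption_strict_mono[OF p D,
        where \<beta> = \<beta> and \<kappa> = \<kappa> and z = z]])
    (use p D \<beta> z assms in \<open>auto simp: c_star_pos wealth_of_c_star\<close>)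

text \<open>\<kappa> < 1 makes the exponent positive, so it lies in (0, 1). The wealth function is
  then strictly concave and its inverse strictly convex.\<close>

lemma c_star_strictly_convex:
  assumes "\<kappa> < 1" "(1 - \<kappa>) * (1 - p) < 1"
  shows "strictly_convex_on {0..} (\<lambda>x. c_star p \<rho> \<beta> \<alpha> \<kappa> x z)"
proof (rule strictly_convex_on_inverse[OF _ wealth_of_consumption_strict_mono[OF p D]])
  have "strictly_concave_on {0<..} (\<lambda>c. c powr ((1 - \<kappa>) * (1 - p)))"
    using assms p by (intro strictly_concave_on_powr) auto
  thus "strictly_concave_on {0<..} (wealth_of_consumption p \<rho> \<beta> \<alpha> \<kappa> z)"
    unfolding strictly_concave_on_def
    \<comment> \<open>Concavity is convexity of the negative, so \<open>k\<close> keeps its sign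
      while \<open>m\<close> and \<open>b\<close> are the negated coefficients of
      \<open>wealth_of_consumption_split\<close>.\<close>
    by (rule strictly_convex_on_affine_combination[where k = "z * \<beta> powr (- (\<kappa> - 1))"
          and m = "- ((1 - p)^2 / (\<rho> * (1 - p) - \<alpha> * p))"
          and b = "(1 - p)^2 / (\<rho> * (1 - p) - \<alpha> * p) * \<beta> powr (- (1 / (1 - p))) + z"])
      (use \<beta> z in \<open>auto simp: wealth_of_consumption_split\<close>)
qed (use p D \<beta> z assms in \<open>auto simp: c_star_pos wealth_of_c_star\<close>)

lemma c_star_strictly_concave:
  assumes "\<kappa> \<le> 1" "(1 - \<kappa>) * (1 - p) > 1"
  shows "strictly_concave_on {0..} (\<lambda>x. c_star p \<rho> \<beta> \<alpha> \<kappa> x z)"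
proof (rule strictly_concave_on_inverse[OF _ wealth_of_consumption_strict_mono[OF p D]])
  show "strictly_convex_on {0<..} (wealth_of_consumption p \<rho> \<beta> \<alpha> \<kappa> z)"
    by (rule strictly_convex_on_affine_combination[OF strictly_convex_on_powr[OF assms(2)] _
          wealth_of_consumption_split])
      (use \<beta> z in simp)
qed (use p D \<beta> z assms in \<open>auto simp: c_star_pos wealth_of_c_star\<close>)

lemma c_star_linear:
  assumes "\<kappa> \<le> 1" "(1 - \<kappa>) * (1 - p) = 1"
  shows "linear_in_on {0..} (\<lambda>x. c_star p \<rho> \<beta> \<alpha> \<kappa> x z)"
proof -
  define A where "A = (1 - p)^2 / (\<rho> * (1 - p) - \<alpha> * p)"
  define B where "B = z * \<beta> powr (- (\<kappa> - 1))"
  define C where "C = A * \<beta> powr (- (1 / (1 - p))) + z"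
  have "A > 0" "B > 0"
    using p D \<beta> z by (simp_all add: A_def B_def)
  have "c_star p \<rho> \<beta> \<alpha> \<kappa> x z = 1 / (A + B) * x + C / (A + B)" if "x \<ge> 0" for x
  proof -
    let ?c = "c_star p \<rho> \<beta> \<alpha> \<kappa> x z"
    \<comment> \<open>Positivity of \<open>?c\<close> enters through
      \<open>?c powr 1 = ?c\<close>.\<close>
    have "x = B * ?c + (A * ?c - C)"
      using wealth_of_c_star[OF p D \<beta> assms(1) that less_imp_le[OF z]]
        c_star_pos[OF p D \<beta> assms(1) that less_imp_le[OF z]]
      by (simp add: wealth_of_consumption_split assms(2) A_def B_def C_def)
    hence "x + C = ?c * (A + B)"
      by (simp add: algebra_simps)
    hence "?c = (x + C) / (A + B)"
      using \<open>A > 0\<close> \<open>B > 0\<close> by simp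
    thus ?thesis
      by (simp add: add_divide_distrib)
  qed
  thus ?thesis
    unfolding linear_in_on_def
    by (intro exI[of _ "1 / (A + B)"] exI[of _ "C / (A + B)"]) simp
qed

text \<open>In terms of consumption, the portfolio is a positive multiple of \<open>c\<close> plus
  nonnegative multiples of a nondecreasing power of \<open>c\<close>. The sign hypothesis concerns
  the coefficient of the benchmark term.\<close>

lemma theta_star_strict_mono:
  assumes "\<kappa> \<le> 1" "\<mu> > 0" "\<sigma> \<noteq> 0" "\<sigma>\<^sub>Z * \<gamma> / \<sigma> \<ge> 0"
  shows "strict_mono_on {0..} (\<lambda>x. theta_star \<mu> \<sigma> \<sigma>\<^sub>Z \<gamma> p \<rho> \<beta> \<alpha> \<kappa> x z)"
proof (rule strict_mono_onI)
  fix x y :: real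
  assume xy: "x \<in> {0..}" "y \<in> {0..}" "x < y"
  let ?c = "\<lambda>x. c_star p \<rho> \<beta> \<alpha> \<kappa> x z"
  have less: "?c x < ?c y"
    by (rule strict_mono_onD[OF c_star_strict_mono[OF assms(1)] xy])
  have pos: "?c x > 0"
    using c_star_pos[OF p D \<beta> assms(1)] xy z by simp
  have theta: "theta_star \<mu> \<sigma> \<sigma>\<^sub>Z \<gamma> p \<rho> \<beta> \<alpha> \<kappa> x z =
      \<mu> / \<sigma>^2 * ((1 - p) / (\<rho> * (1 - p) - \<alpha> * p) * ?c x
        + (1 - \<kappa>) * \<beta> powr (- (\<kappa> - 1)) * z * ?c x powr ((1 - \<kappa>) * (1 - p)))
      + \<sigma>\<^sub>Z * \<gamma> / \<sigma> * z * \<beta> powr (- (\<kappa> - 1)) * ?c x powr ((1 - \<kappa>) * (1 - p))" if "x \<ge> 0" for x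
    unfolding theta_star_def
    using f_dual_powr_p[OF p D \<beta> assms(1) that] f_dual_powr_kappa[OF p D \<beta> assms(1) that] z
    by simp
  have "?c x powr ((1 - \<kappa>) * (1 - p)) \<le> ?c y powr ((1 - \<kappa>) * (1 - p))"
    using less pos assms p by (intro powr_mono2) auto
  moreover have "\<sigma>\<^sub>Z * \<gamma> / \<sigma> * z * \<beta> powr (- (\<kappa> - 1)) \<ge> 0"
    using assms(4) z by (intro mult_nonneg_nonneg) auto
  ultimately show "theta_star \<mu> \<sigma> \<sigma>\<^sub>Z \<gamma> p \<rho> \<beta> \<alpha> \<kappa> x z < theta_star \<mu> \<sigma> \<sigma>\<^sub>Z \<gamma> p \<rho> \<beta> \<alpha> \<kappa> y z"
    using xy less assms p D z
    by (simp only: theta atLeast_iff)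
      (intro add_less_le_mono mult_strict_left_mono mult_left_mono, auto)
qed

text \<open>Since \<open>m\<close> and \<open>b\<close> do not depend on \<open>x\<close>, the
  curvature of the portfolio is that of consumption, up to the sign of the displayed
  coefficient.\<close>

lemma theta_star_affine_in_c_star:
  assumes "\<kappa> \<le> 1" "\<sigma> \<noteq> 0"
  obtains m b where "\<And>x. x \<ge> 0 \<Longrightarrow> theta_star \<mu> \<sigma> \<sigma>\<^sub>Z 1 p \<rho> \<beta> \<alpha> \<kappa> x z =
    (1 - p) / (\<rho> * (1 - p) - \<alpha> * p) / \<sigma>^2 * (\<mu> - (\<mu> * (1 - \<kappa>) + \<sigma> * \<sigma>\<^sub>Z) * (1 - p))
      * c_star p \<rho> \<beta> \<alpha> \<kappa> x z + (m * x + b)"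
proof -
  define a where "a = (1 - p) / (\<rho> * (1 - p) - \<alpha> * p)"
  \<comment> \<open>The total coefficient of the power term \<open>E\<close> in the
    portfolio.\<close>
  define m where "m = (\<mu> * (1 - \<kappa>) + \<sigma> * \<sigma>\<^sub>Z) / \<sigma>^2"
  have A: "(1 - p)^2 / (\<rho> * (1 - p) - \<alpha> * p) = (1 - p) * a"
    by (simp add: a_def power2_eq_square)
  have m: "m = \<mu> / \<sigma>^2 * (1 - \<kappa>) + \<sigma>\<^sub>Z / \<sigma>"
    using assms(2) by (simp add: m_def field_simps power2_eq_square)
  \<comment> \<open>The constants left over when \<open>E\<close> is replaced by its value from the
    wealth equation.\<close>
  define b where "b = m * (z + (1 - p) * a * \<beta> powr (- (1 / (1 - p))))"
  show ?thesis
  proof (rule that)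
    fix x :: real
    assume x: "x \<ge> 0"
    let ?c = "c_star p \<rho> \<beta> \<alpha> \<kappa> x z"
    define E where "E = z * \<beta> powr (- (\<kappa> - 1)) * ?c powr ((1 - \<kappa>) * (1 - p))"
    note c = wealth_of_c_star[OF p D \<beta> assms(1) x less_imp_le[OF z]]
      f_dual_powr_p[OF p D \<beta> assms(1) x less_imp_le[OF z]]
      f_dual_powr_kappa[OF p D \<beta> assms(1) x less_imp_le[OF z]]
    have "theta_star \<mu> \<sigma> \<sigma>\<^sub>Z 1 p \<rho> \<beta> \<alpha> \<kappa> x z = \<mu> / \<sigma>^2 * a * ?c + m * E"
    proof -
      have "M * (a * u + k * B * z * e) + N * 1 / \<sigma> * z * B * e =
          M * a * u + (M * k + N / \<sigma>) * (z * B * e)"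
        for M k B N u e :: real
        by (simp add: algebra_simps)
      thus ?thesis
        unfolding theta_star_def c(2,3) m E_def a_def[symmetric] .
    qed
    also have "E = x + z - (1 - p) * a * (?c - \<beta> powr (- (1 / (1 - p))))"
      using c(1) unfolding wealth_of_consumption_def A E_def by (simp add: algebra_simps)
    also have "\<mu> / \<sigma>^2 * a * ?c + m * \<dots> = (\<mu> / \<sigma>^2 - m * (1 - p)) * a * ?c + (m * x + b)"
      by (simp add: b_def algebra_simps)
    also have "\<mu> / \<sigma>^2 - m * (1 - p) = (\<mu> - (\<mu> * (1 - \<kappa>) + \<sigma> * \<sigma>\<^sub>Z) * (1 - p)) / \<sigma>^2"
      by (simp add: m_def diff_divide_distrib)
    finally show "theta_star \<mu> \<sigma> \<sigma>\<^sub>Z 1 p \<rho> \<beta> \<alpha> \<kappa> x z =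
        (1 - p) / (\<rho> * (1 - p) - \<alpha> * p) / \<sigma>^2 * (\<mu> - (\<mu> * (1 - \<kappa>) + \<sigma> * \<sigma>\<^sub>Z) * (1 - p))
          * ?c + (m * x + b)"
      by (simp add: a_def mult_ac)
  qed
qed

end

section \<open>The root \<kappa>, the critical values of \<open>p\<close> and the case
  analysis\<close>

text \<open>\<open>\<kappa>\<close> is the positive root of \<open>\<alpha> k\<^sup>2 + (\<rho> - \<eta> - \<alpha>) k - (\<rho> - \<mu>\<^sub>Z)\<close>, whose value at \<open>1\<close> is
  \<open>\<mu>\<^sub>Z - \<eta> \<ge> 0\<close>.\<close>

lemma positive_root_bounds:
  fixes \<alpha> b c :: real
  assumes "\<alpha> > 0" "c > 0" "\<alpha> + b \<ge> c"
  shows "0 < (- b + sqrt (b^2 + 4 * \<alpha> * c)) / (2 * \<alpha>)" "(- b + sqrt (b^2 + 4 * \<alpha> * c)) / (2 * \<alpha>) \<le> 1"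
proof -
  have "b < sqrt (b^2 + 4 * \<alpha> * c)"
    using assms by (intro real_less_rsqrt) simp
  thus "0 < (- b + sqrt (b^2 + 4 * \<alpha> * c)) / (2 * \<alpha>)"
    using assms by simp
  \<comment> \<open>Up to the factor 4 and common terms, this is the squared form of the bound
    \<open>2 * \<alpha> + b\<close> on the square root.\<close>
  have "\<alpha> * c \<le> \<alpha> * (\<alpha> + b)"
    using assms by simp
  hence "b^2 + 4 * \<alpha> * c \<le> (2 * \<alpha> + b)^2"
    by (simp add: power2_eq_square algebra_simps)
  hence "sqrt (b^2 + 4 * \<alpha> * c) \<le> 2 * \<alpha> + b"
    using assms by (intro real_le_lsqrt) auto
  thus "(- b + sqrt (b^2 + 4 * \<alpha> * c)) / (2 * \<alpha>) \<le> 1"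
    using assms by simp
qed

text \<open>The value \<kappa> = 1, attained exactly when \<open>\<mu>\<^sub>Z = \<eta>\<close>, is
  set apart because \<open>p\<^sub>1\<close> divides by \<open>1 - \<kappa>\<close>. The sign of
  \<open>\<sigma> * \<sigma>\<^sub>Z\<close> controls the benchmark term for \<gamma> = 1; if this
  product is 0 and \<kappa> is not 1, then \<open>p\<^sub>1 = p\<^sub>2\<close>.\<close>

theorem proposition4p7:
  fixes \<mu> \<sigma> \<gamma> \<sigma>\<^sub>Z \<mu>\<^sub>Z \<beta> \<rho> p \<alpha> \<eta> \<kappa> p\<^sub>1 p\<^sub>2 :: real
  assumes "\<mu> > 0" and "\<sigma> \<noteq> 0" and "\<gamma> \<in> {-1, 1}" and "\<sigma>\<^sub>Z \<ge> 0"
    and "\<beta> > 0" and "\<rho> > 0" and "p < 1"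
    and "\<alpha> = \<mu>^2 / (2 * \<sigma>^2)"
    and "\<eta> = \<sigma>\<^sub>Z * \<gamma> * \<mu> / \<sigma>"
    and "\<mu>\<^sub>Z \<ge> \<eta>"
    and "\<rho> > rho0 p \<alpha> \<mu>\<^sub>Z"
    and "\<kappa> = (- (\<rho> - \<eta> - \<alpha>) + sqrt ((\<rho> - \<eta> - \<alpha>)^2 + 4 * \<alpha> * (\<rho> - \<mu>\<^sub>Z))) / (2 * \<alpha>)"
    and "p\<^sub>1 = - (\<kappa> / (1 - \<kappa>))"
    and "p\<^sub>2 = (\<sigma> * \<sigma>\<^sub>Z - \<mu> * \<kappa>) / (\<mu> * (1 - \<kappa>) + \<sigma> * \<sigma>\<^sub>Z)"
  shows
    "\<kappa> > 0
     \<and> (\<kappa> \<noteq> 1 \<longrightarrow> p\<^sub>1 < 0)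
     \<and> (\<kappa> \<noteq> 1 \<and> \<sigma> * \<sigma>\<^sub>Z > 0 \<longrightarrow> p\<^sub>1 < p\<^sub>2 \<and> p\<^sub>2 < 1)
     \<and> (\<forall>z>0.
          strict_mono_on {0..} (\<lambda>x. c_star p \<rho> \<beta> \<alpha> \<kappa> x z)
          \<and> (\<kappa> \<noteq> 1 \<longrightarrow>
               (p \<in> {p\<^sub>1<..<1} \<longrightarrow> strictly_convex_on {0..} (\<lambda>x. c_star p \<rho> \<beta> \<alpha> \<kappa> x z))
             \<and> (p \<in> {..<p\<^sub>1} \<longrightarrow> strictly_concave_on {0..} (\<lambda>x. c_star p \<rho> \<beta> \<alpha> \<kappa> x z))
             \<and> (p = p\<^sub>1 \<longrightarrow> linear_in_on {0..} (\<lambda>x. c_star p \<rho> \<beta> \<alpha> \<kappa> x z)))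
          \<and> (\<gamma> = 1 \<and> \<sigma> * \<sigma>\<^sub>Z \<ge> 0 \<longrightarrow>
               strict_mono_on {0..} (\<lambda>x. theta_star \<mu> \<sigma> \<sigma>\<^sub>Z \<gamma> p \<rho> \<beta> \<alpha> \<kappa> x z))
          \<and> (\<gamma> = 1 \<and> \<kappa> \<noteq> 1 \<and> \<sigma> * \<sigma>\<^sub>Z \<ge> 0 \<longrightarrow>
               (p \<in> {..<p\<^sub>1} \<union> {p\<^sub>2<..<1} \<longrightarrow>
                  strictly_convex_on {0..} (\<lambda>x. theta_star \<mu> \<sigma> \<sigma>\<^sub>Z \<gamma> p \<rho> \<beta> \<alpha> \<kappa> x z))
             \<and> (p \<in> {p\<^sub>1<..<p\<^sub>2} \<longrightarrow>
                  strictly_concave_on {0..} (\<lambda>x. theta_star \<mu> \<sigma> \<sigma>\<^sub>Z \<gamma> p \<rho> \<beta> \<alpha> \<kappa> x z))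
             \<and> (p = p\<^sub>1 \<or> p = p\<^sub>2 \<longrightarrow>
                  linear_in_on {0..} (\<lambda>x. theta_star \<mu> \<sigma> \<sigma>\<^sub>Z \<gamma> p \<rho> \<beta> \<alpha> \<kappa> x z))))"
proof -
  have \<alpha>: "\<alpha> > 0"
    using assms(1,2,8) by simp
  have \<rho>: "\<rho> > \<mu>\<^sub>Z"
    using assms(11) by (simp add: rho0_def split: if_splits)
  have D: "\<rho> * (1 - p) - \<alpha> * p > 0"
  proof (cases "p > 0")
    case True
    then show ?thesis
      using assms(7,11) by (simp add: rho0_def field_simps)
  next
    case False
    hence "\<rho> * (1 - p) > 0" "\<alpha> * p \<le> 0"
      using assms(6) \<alpha> by (simp_all add: mult_nonneg_nonpos)
    then show ?thesis
      by simp
  qed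
  \<comment> \<open>With \<open>b = \<rho> - \<eta> - \<alpha>\<close> and
    \<open>c = \<rho> - \<mu>\<^sub>Z\<close>, the condition \<open>\<alpha> + b \<ge> c\<close>
    says \<open>\<mu>\<^sub>Z \<ge> \<eta>\<close>.\<close>
  have \<kappa>: "0 < \<kappa>" "\<kappa> \<le> 1"
    using positive_root_bounds[of \<alpha> "\<rho> - \<mu>\<^sub>Z" "\<rho> - \<eta> - \<alpha>"] \<alpha> \<rho> assms(10) by (simp_all add: assms(12))
  \<comment> \<open>\<open>p\<^sub>1\<close> is the value of \<open>p\<close> at which the exponent
    of \<open>c\<close> equals 1.\<close>
  have p1: "(1 - \<kappa>) * (1 - p\<^sub>1) = 1" "p\<^sub>1 < 0" if "\<kappa> \<noteq> 1"
    using \<kappa> that by (simp_all add: assms(13) field_simps)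
  have den: "\<mu> * (1 - \<kappa>) + \<sigma> * \<sigma>\<^sub>Z > 0" if "\<kappa> \<noteq> 1" "\<sigma> * \<sigma>\<^sub>Z \<ge> 0"
    using \<kappa> assms(1) that by (intro add_pos_nonneg) auto
  \<comment> \<open>\<open>p\<^sub>2\<close> is the value of \<open>p\<close> at which the
    coefficient of consumption in the portfolio vanishes.\<close>
  have p2: "(\<mu> * (1 - \<kappa>) + \<sigma> * \<sigma>\<^sub>Z) * (1 - p\<^sub>2) = \<mu>" if "\<kappa> \<noteq> 1" "\<sigma> * \<sigma>\<^sub>Z \<ge> 0"
    using den[OF that] by (simp add: assms(14) field_simps)
  have p2_less: "p\<^sub>2 < 1" if "\<kappa> \<noteq> 1" "\<sigma> * \<sigma>\<^sub>Z \<ge> 0"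
    using zero_less_mult_pos[of "\<mu> * (1 - \<kappa>) + \<sigma> * \<sigma>\<^sub>Z" "1 - p\<^sub>2"] p2[OF that] den[OF that]
      assms(1) by simp
  \<comment> \<open>Subtracting the characterisations of the two critical values orders them by the
    sign of \<open>\<sigma> * \<sigma>\<^sub>Z\<close>.\<close>
  have diff: "\<mu> * (1 - \<kappa>) * (p\<^sub>2 - p\<^sub>1) = \<sigma> * \<sigma>\<^sub>Z * (1 - p\<^sub>2)" if "\<kappa> \<noteq> 1" "\<sigma> * \<sigma>\<^sub>Z \<ge> 0"
  proof -
    have "\<mu> * ((1 - \<kappa>) * (1 - p\<^sub>1)) = \<mu>"
      using p1(1)[OF that(1)] by simp
    with p2[OF that] show ?thesis
      by (simp add: algebra_simps)
  qed
  have p12: "p\<^sub>1 < p\<^sub>2" if "\<kappa> \<noteq> 1" "\<sigma> * \<sigma>\<^sub>Z > 0"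
  proof -
    have "\<mu> * (1 - \<kappa>) * (p\<^sub>2 - p\<^sub>1) > 0"
      using diff p2_less that by simp
    thus ?thesis
      using \<kappa> that(1) assms(1) by (auto simp: zero_less_mult_iff mult_less_0_iff)
  qed
  have p12_le: "p\<^sub>1 \<le> p\<^sub>2" if "\<kappa> \<noteq> 1" "\<sigma> * \<sigma>\<^sub>Z \<ge> 0"
  proof -
    have "\<mu> * (1 - \<kappa>) * (p\<^sub>2 - p\<^sub>1) \<ge> 0"
      using diff p2_less that by (simp add: less_imp_le)
    thus ?thesis
      using \<kappa> that(1) assms(1) by (auto simp: zero_le_mult_iff mult_le_0_iff)
  qed
  have exponent: "(1 - \<kappa>) * (1 - p) = 1 - (1 - \<kappa>) * (p - p\<^sub>1)" if "\<kappa> \<noteq> 1"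
    using p1(1)[OF that] by (simp add: algebra_simps)
  note ctxt = assms(7) D assms(5)
  have convex: "strictly_convex_on {0..} (\<lambda>x. c_star p \<rho> \<beta> \<alpha> \<kappa> x z)"
    if "z > 0" "\<kappa> \<noteq> 1" "p > p\<^sub>1" for z
    using that \<kappa> exponent by (intro c_star_strictly_convex[OF ctxt]) auto
  have concave: "strictly_concave_on {0..} (\<lambda>x. c_star p \<rho> \<beta> \<alpha> \<kappa> x z)"
    if "z > 0" "\<kappa> \<noteq> 1" "p < p\<^sub>1" for z
    using that \<kappa> exponent
    by (intro c_star_strictly_concave[OF ctxt]) (auto simp: mult_less_0_iff)
  have linear: "linear_in_on {0..} (\<lambda>x. c_star p \<rho> \<beta> \<alpha> \<kappa> x z)"
    if "z > 0" "\<kappa> \<noteq> 1" "p = p\<^sub>1" for z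
    using that \<kappa> p1(1) by (intro c_star_linear[OF ctxt]) auto
  have theta: "(p \<in> {..<p\<^sub>1} \<union> {p\<^sub>2<..<1} \<longrightarrow>
        strictly_convex_on {0..} (\<lambda>x. theta_star \<mu> \<sigma> \<sigma>\<^sub>Z \<gamma> p \<rho> \<beta> \<alpha> \<kappa> x z))
      \<and> (p \<in> {p\<^sub>1<..<p\<^sub>2} \<longrightarrow>
        strictly_concave_on {0..} (\<lambda>x. theta_star \<mu> \<sigma> \<sigma>\<^sub>Z \<gamma> p \<rho> \<beta> \<alpha> \<kappa> x z))
      \<and> (p = p\<^sub>1 \<or> p = p\<^sub>2 \<longrightarrow>
        linear_in_on {0..} (\<lambda>x. theta_star \<mu> \<sigma> \<sigma>\<^sub>Z \<gamma> p \<rho> \<beta> \<alpha> \<kappa> x z))"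
    if z: "z > 0" and "\<gamma> = 1" and "\<kappa> \<noteq> 1" and "\<sigma> * \<sigma>\<^sub>Z \<ge> 0" for z
  proof -
    define K where "K = (1 - p) / (\<rho> * (1 - p) - \<alpha> * p) / \<sigma>^2
      * (\<mu> - (\<mu> * (1 - \<kappa>) + \<sigma> * \<sigma>\<^sub>Z) * (1 - p))"
    obtain m b where \<theta>: "\<And>x. x \<ge> 0 \<Longrightarrow> theta_star \<mu> \<sigma> \<sigma>\<^sub>Z \<gamma> p \<rho> \<beta> \<alpha> \<kappa> x z =
        K * c_star p \<rho> \<beta> \<alpha> \<kappa> x z + (m * x + b)"
      using theta_star_affine_in_c_star[OF ctxt z \<kappa>(2) assms(2), of \<mu> \<sigma>\<^sub>Z] \<open>\<gamma> = 1\<close>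
      unfolding K_def by metis
    have "\<mu> - (\<mu> * (1 - \<kappa>) + \<sigma> * \<sigma>\<^sub>Z) * (1 - p) = (\<mu> * (1 - \<kappa>) + \<sigma> * \<sigma>\<^sub>Z) * (p - p\<^sub>2)"
      using p2[OF that(3,4)] by (simp add: algebra_simps)
    hence K: "K = (1 - p) / (\<rho> * (1 - p) - \<alpha> * p) / \<sigma>^2 * (\<mu> * (1 - \<kappa>) + \<sigma> * \<sigma>\<^sub>Z) * (p - p\<^sub>2)"
      by (simp add: K_def)
    have pos: "(1 - p) / (\<rho> * (1 - p) - \<alpha> * p) / \<sigma>^2 * (\<mu> * (1 - \<kappa>) + \<sigma> * \<sigma>\<^sub>Z) > 0"
      using D assms(2,7) den[OF that(3,4)] by simp
    have K_pos: "K > 0" if "p > p\<^sub>2"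
      unfolding K by (rule mult_pos_pos[OF pos]) (use that in simp)
    have K_neg: "K < 0" if "p < p\<^sub>2"
      unfolding K by (rule mult_pos_neg[OF pos]) (use that in simp)
    show ?thesis
    proof (intro conjI impI)
      assume p: "p \<in> {..<p\<^sub>1} \<union> {p\<^sub>2<..<1}"
      show "strictly_convex_on {0..} (\<lambda>x. theta_star \<mu> \<sigma> \<sigma>\<^sub>Z \<gamma> p \<rho> \<beta> \<alpha> \<kappa> x z)"
      \<comment> \<open>Two sources of convexity: below \<open>p\<^sub>1\<close> consumption is
        concave and \<open>K < 0\<close>; above \<open>p\<^sub>2\<close> consumption is convex and
        \<open>K > 0\<close>.\<close>
      proof (cases "p < p\<^sub>1")
        case True
        hence "- K > 0"
          using K_neg p12_le[OF that(3,4)] by linarith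
        with concave[OF z that(3) True, unfolded strictly_concave_on_def] show ?thesis
          by (rule strictly_convex_on_affine_combination) (simp add: \<theta>)
      next
        case False
        hence "p > p\<^sub>2"
          using p by simp
        moreover from this have "p > p\<^sub>1"
          using p12_le[OF that(3,4)] by linarith
        ultimately show ?thesis
          by (intro strictly_convex_on_affine_combination[OF convex[OF z that(3)] K_pos])
            (simp_all add: \<theta>)
      qed
    next
      assume p: "p \<in> {p\<^sub>1<..<p\<^sub>2}"
      hence "- K > 0"
        using K_neg by simp
      show "strictly_concave_on {0..} (\<lambda>x. theta_star \<mu> \<sigma> \<sigma>\<^sub>Z \<gamma> p \<rho> \<beta> \<alpha> \<kappa> x z)"
        unfolding strictly_concave_on_def
      proof (rule strictly_convex_on_affine_combination[OF convex[OF z that(3)] \<open>- K > 0\<close>])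
        show "p > p\<^sub>1"
          using p by simp
        show "- theta_star \<mu> \<sigma> \<sigma>\<^sub>Z \<gamma> p \<rho> \<beta> \<alpha> \<kappa> x z =
            - K * c_star p \<rho> \<beta> \<alpha> \<kappa> x z + (- m * x + - b)" if "x \<in> {0..}" for x
          using that by (simp add: \<theta>)
      qed
    next
      assume "p = p\<^sub>1 \<or> p = p\<^sub>2"
      \<comment> \<open>At \<open>p\<^sub>1\<close> consumption itself is affine; at
        \<open>p\<^sub>2\<close> it drops out because \<open>K = 0\<close>.\<close>
      then show "linear_in_on {0..} (\<lambda>x. theta_star \<mu> \<sigma> \<sigma>\<^sub>Z \<gamma> p \<rho> \<beta> \<alpha> \<kappa> x z)"
      proof
        assume "p = p\<^sub>1"
        then obtain a d where "\<forall>x\<in>{0..}. c_star p \<rho> \<beta> \<alpha> \<kappa> x z = a * x + d"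
          using linear[OF z \<open>\<kappa> \<noteq> 1\<close>] unfolding linear_in_on_def by blast
        hence "\<forall>x\<in>{0..}. theta_star \<mu> \<sigma> \<sigma>\<^sub>Z \<gamma> p \<rho> \<beta> \<alpha> \<kappa> x z = (K * a + m) * x + (K * d + b)"
          using \<theta> by (simp add: algebra_simps)
        thus ?thesis
          unfolding linear_in_on_def by blast
      next
        assume "p = p\<^sub>2"
        hence "K = 0"
          by (simp add: K)
        hence "\<forall>x\<in>{0..}. theta_star \<mu> \<sigma> \<sigma>\<^sub>Z \<gamma> p \<rho> \<beta> \<alpha> \<kappa> x z = m * x + b"
          using \<theta> by simp
        thus ?thesis
          unfolding linear_in_on_def by blast
      qed
    qed
  qed
  have theta_mono: "strict_mono_on {0..} (\<lambda>x. theta_star \<mu> \<sigma> \<sigma>\<^sub>Z \<gamma> p \<rho> \<beta> \<alpha> \<kappa> x z)"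
    if "z > 0" "\<gamma> = 1" "\<sigma> * \<sigma>\<^sub>Z \<ge> 0" for z
    using that assms(1,2) \<kappa>(2)
    by (intro theta_star_strict_mono[OF ctxt]) (auto simp: zero_le_divide_iff zero_le_mult_iff)
  show ?thesis
    using \<kappa>(1) p1(2) p12 p2_less c_star_strict_mono[OF ctxt _ \<kappa>(2)] convex concave linear theta
      theta_mono by simp
qed

end
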